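(* Let $0<p<1$, $q=1-p$, and let $(\alpha_n)_{n\in\mathbb{N}}$ be a real sequence with $\alpha_n/n\to 0$ and $\alpha_n/\sqrt{n}\to\infty$ as $n\to\infty$. Let $k_n=pn-\alpha_n$ and $f_n=k_n/n$. Then $$\lim_{n\to\infty}B_{n,\lfloor k_n\rfloor}^{\downarrow}(p)\frac{\alpha_n}{\sqrt{n}}e^{nD(f_n\|p)}=\lim_{n\to\infty}B_{n,\lfloor k_n\rfloor}(p)\frac{\alpha_n}{\sqrt{n}}e^{nD(f_n\|p)}=\lim_{n\to\infty}B_{n,\lfloor k_n\rfloor}^{\uparrow}(p)\frac{\alpha_n}{\sqrt{n}}e^{nD(f_n\|p)}=\sqrt{\frac{pq}{2\pi}}.$$
   Context: $\mathbb{N}$ denotes the positive integers and $\mathbb{N}_0$ the nonnegative integers. For integers $0\le k\le n$, $B_{n,k}(p)=\sum_{j=0}^k\binom{n}{j}p^jq^{n-j}$. The relative entropy is $D(f\|p)=f\ln\frac{f}{p}+(1-f)\ln\frac{1-f}{1-p}$. For $n\ge 0$, $0<p<1$, $0\le k\le pn$ define $$L(n,k,p)=\frac{k+1-pn+\sqrt{(pn-k+1)^2+4qk}}{2},$$ $$V(n,k,p,a)=a+\frac{p(n-k+a+1)}{pn+p-k+a},\qquad U(n,k,p)=\min_{a\in\mathbb{N}_0}V(n,k,p,a).$$ For $0<p<1$ and $1\le k\le n-1$ define $$B_{n,k}^{\downarrow}(p)=\frac{\sqrt{n}\,L(n,k,p)}{\sqrt{2\pi k(n-k)}}\,e^{-nD(\frac{k}{n}\|p)}\,e^{\frac{1}{12n}-\frac{1}{12k}-\frac{1}{12(n-k)}},$$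 $$B_{n,k}^{\uparrow}(p)=\frac{\sqrt{n}\,U(n,k,p)}{\sqrt{2\pi k(n-k)}}\,e^{-nD(\frac{k}{n}\|p)}\,e^{\frac{1}{12n+1}-\frac{1}{12k+1}-\frac{1}{12(n-k)+1}}.$$ The quantities in the limits are defined for all sufficiently large $n$. *)

theory Defs
  imports Complex_Main
begin

definition binom_cdf :: "nat \<Rightarrow> nat \<Rightarrow> real \<Rightarrow> real" where
  "binom_cdf n k p = (\<Sum>j = 0..k. real (n choose j) * p ^ j * (1 - p) ^ (n - j))"

text \<open>Since \<open>ln 0 = 0\<close> here, the usual convention \<open>0 ln 0 = 0\<close> holds for \<open>f = 0\<close> and \<open>f = 1\<close>.\<close>

definition rel_entropy :: "real \<Rightarrow> real \<Rightarrow> real" where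
  "rel_entropy f p = f * ln (f / p) + (1 - f) * ln ((1 - f) / (1 - p))"

definition L :: "nat \<Rightarrow> nat \<Rightarrow> real \<Rightarrow> real" where
  "L n k p =
     (real k + 1 - p * real n
        + sqrt ((p * real n - real k + 1)\<^sup>2 + 4 * (1 - p) * real k)) / 2"

definition V :: "nat \<Rightarrow> nat \<Rightarrow> real \<Rightarrow> nat \<Rightarrow> real" where
  "V n k p a =
     real a + p * (real n - real k + real a + 1) / (p * real n + p - real k + real a)"

text \<open>The infimum is a minimum in the intended range \<open>0 \<le> k \<le> p n\<close>;
  see \<open>U_attained\<close> below.\<close>

definition U :: "nat \<Rightarrow> nat \<Rightarrow> real \<Rightarrow> real" where
  "U n k p = (INF a. V n k p a)"

lemma U_attained:
  assumes "0 < p" "p < 1" "real k \<le> p * real n"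
  shows "\<exists>a. U n k p = V n k p a \<and> (\<forall>b. V n k p a \<le> V n k p b)"
proof -
  have "p * real n \<le> real n"
    using assms by (simp add: mult_left_le_one_le)
  then have V_ge: "real a \<le> V n k p a" for a
    using assms unfolding V_def by simp
  define S where "S = {a. real a \<le> V n k p 0}"
  have "S \<subseteq> {..nat \<lfloor>V n k p 0\<rfloor>}"
    by (auto simp: S_def le_nat_floor)
  then have fin: "finite S"
    by (rule finite_subset) simp
  have "0 \<in> S"
    using V_ge[of 0] by (simp add: S_def)
  then obtain a where a: "a \<in> S" "\<And>b. b \<in> S \<Longrightarrow> V n k p a \<le> V n k p b"
    using ex_min_if_finite[of "V n k p ` S"] fin
    by (metis arg_min_if_finite(1) arg_min_least empty_iff)
  have min: "V n k p a \<le> V n k p b" for b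
  proof (cases "b \<in> S")
    case False
    then have "V n k p 0 < real b" by (simp add: S_def)
    then show ?thesis
      using a(2)[OF \<open>0 \<in> S\<close>] V_ge[of b] by linarith
  qed (rule a(2))
  then have "U n k p = V n k p a"
    unfolding U_def by (intro cInf_eq_minimum) auto
  with min show ?thesis by blast
qed

definition B_down :: "nat \<Rightarrow> nat \<Rightarrow> real \<Rightarrow> real" where
  "B_down n k p =
     sqrt (real n) * L n k p / sqrt (2 * pi * real k * (real n - real k))
     * exp (- real n * rel_entropy (real k / real n) p)
     * exp (1 / (12 * real n) - 1 / (12 * real k) - 1 / (12 * (real n - real k)))"

definition B_up :: "nat \<Rightarrow> nat \<Rightarrow> real \<Rightarrow> real" where
  "B_up n k p =
     sqrt (real n) * U n k p / sqrt (2 * pi * real k * (real n - real k))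
     * exp (- real n * rel_entropy (real k / real n) p)
     * exp (1 / (12 * real n + 1) - 1 / (12 * real k + 1)
            - 1 / (12 * (real n - real k) + 1))"

end

theory Submission
  imports Defs "HOL-Analysis.Analysis" "HOL-Real_Asymp.Real_Asymp"
begin

text \<open>
  Write \<open>m = \<lfloor>k\<^sub>n\<rfloor>\<close>, \<open>a = pn - m\<close> and \<open>b(j)\<close> for the \<open>j\<close>-th binomial probability. By Stirling's
  formula \<open>b(m)\<close> is asymptotic to
  \<open>W = sqrt (n / (2 \<pi> m (n - m))) * exp (- n D(m/n || p))\<close>, so each of the three quantities is \<open>X W\<close>
  up to a factor tending to \<open>1\<close>, where \<open>X\<close> is \<open>L\<close>, \<open>B / b(m)\<close> or \<open>U\<close>, and it suffices to show
  \<open>X a / n \<rightarrow> p q\<close>. For \<open>B / b(m)\<close> this follows by comparing \<open>\<Sum>i. b(m - i) / b(m)\<close> with geometric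
  series: the ratio at \<open>i = 0\<close> gives the upper bound \<open>V(0)\<close>, and the ratio at \<open>i = s\<close>, applied to
  the first \<open>s\<close> terms with \<open>s\<close> of order \<open>sqrt n\<close>, gives the lower bound. The minimum \<open>U\<close> equals
  \<open>V(0)\<close> as soon as \<open>a\<^sup>2 \<ge> n\<close>. Finally, \<open>m\<close> may be replaced by
  \<open>k\<^sub>n\<close> in the exponent since \<open>|k\<^sub>n - m| \<le> 1\<close> and the derivative of \<open>D(. || p)\<close> vanishes at \<open>p\<close>.
\<close>

subsection \<open>Stirling's formula\<close>

text \<open>At \<open>n = 0\<close> the denominator vanishes and the value is \<open>0\<close>, so
  positivity and the formula for the logarithm are restricted to \<open>n > 0\<close>.\<close>

definition stirling_ratio :: "nat \<Rightarrow> real" where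
  "stirling_ratio n = fact n / (sqrt (2 * pi * real n) * (real n / exp 1) ^ n)"

lemma stirling_ratio_pos: "n > 0 \<Longrightarrow> stirling_ratio n > 0"
  by (simp add: stirling_ratio_def)

lemma ln_stirling_ratio:
  assumes "n > 0"
  shows "ln (stirling_ratio n) =
    ln (fact n) - ln (2 * pi) / 2 - (real n + 1 / 2) * ln (real n) + real n"
  using assms
  by (simp add: stirling_ratio_def ln_div ln_mult ln_sqrt ln_realpow algebra_simps add_divide_distrib)

text \<open>The logarithm has increments of order \<open>1 / n^2\<close>, so it converges by
  telescoping, and exponentiating makes the limit positive. Its value comes later from the Wallis
  product.\<close>

lemma stirling_ratio_convergent: "\<exists>c>0. stirling_ratio \<longlonglongrightarrow> c"
proof -
  define l where "l n = ln (stirling_ratio (Suc n))" for n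
  have "l (Suc n) - l n = 1 - (real n + 3 / 2) * ln ((real n + 2) / (real n + 1))" for n
  proof -
    have "ln (fact (Suc (Suc n))) = ln (real n + 2) + ln (fact (Suc n))"
      by (subst fact_Suc) (simp add: ln_mult del: fact_Suc)
    then show ?thesis
      by (simp add: l_def ln_stirling_ratio ln_div algebra_simps del: fact_Suc)
  qed
  \<comment> \<open>With \<open>x = n + 3/2\<close> the quotient is
    \<open>(x + 1/2) / (x - 1/2)\<close>, whose logarithm is \<open>1/x + 1/(12 x^3) + ...\<close>;
    the expression is therefore about \<open>-1/(12 x^2)\<close>.\<close>
  moreover have "(\<lambda>n::nat. 1 - (real n + 3 / 2) * ln ((real n + 2) / (real n + 1)))
      \<in> O(\<lambda>n. 1 / real n ^ 2)"
    by real_asymp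
  moreover have "summable (\<lambda>n. norm (1 / real n ^ 2))"
    using inverse_power_summable[of 2, where ?'a = real] by (simp add: divide_inverse)
  ultimately have "summable (\<lambda>n. l (Suc n) - l n)"
    by (simp only: summable_comparison_test_bigo)
  then obtain x where "(\<lambda>n. l n - l 0) \<longlonglongrightarrow> x"
    by (auto simp: summable_def sums_def sum_lessThan_telescope)
  then have "l \<longlonglongrightarrow> x + l 0"
    by (auto dest: tendsto_add[OF _ tendsto_const[of "l 0"]])
  then have "(\<lambda>n. exp (l n)) \<longlonglongrightarrow> exp (x + l 0)"
    by (intro tendsto_intros)
  then have "(\<lambda>n. stirling_ratio (Suc n)) \<longlonglongrightarrow> exp (x + l 0)"
    by (simp add: l_def stirling_ratio_pos)
  then show ?thesis
    by (auto simp: filterlim_sequentially_Suc intro!: exI[of _ "exp (x + l 0)"])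
qed

text \<open>Factorial form of the Wallis product, into which the Stirling ratios at \<open>n\<close>
  and \<open>2 * n\<close> can be substituted.\<close>

lemma wallis_product_eq:
  "(\<Prod>k=1..n. (4 * real k ^ 2) / (4 * real k ^ 2 - 1)) =
    16 ^ n * fact n ^ 4 / (fact (2 * n) ^ 2 * (2 * real n + 1))"
proof (induction n)
  case (Suc n)
  define x where "x = real n"
  define F where "F = (fact n :: real)"
  define G where "G = (fact (2 * n) :: real)"
  have pos: "x \<ge> 0" "F > 0" "G > 0" by (auto simp: x_def F_def G_def)
  have 1: "(\<Prod>k=1..Suc n. (4 * real k ^ 2) / (4 * real k ^ 2 - 1)) =
    16 ^ n * F ^ 4 / (G ^ 2 * (2 * x + 1)) * ((4 * (x + 1) ^ 2) / ((2 * x + 1) * (2 * x + 3)))"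
    using Suc by (simp add: F_def G_def x_def power2_eq_square algebra_simps)
  have 2: "(fact (Suc n) :: real) = (x + 1) * F"
    "(fact (2 * Suc n) :: real) = (2 * x + 2) * (2 * x + 1) * G"
    by (simp_all add: x_def F_def G_def algebra_simps)
  have "16 ^ n * F ^ 4 / (G ^ 2 * (2 * x + 1)) * ((4 * (x + 1) ^ 2) / ((2 * x + 1) * (2 * x + 3)))
    = 16 ^ Suc n * ((x + 1) * F) ^ 4 / (((2 * x + 2) * (2 * x + 1) * G) ^ 2 * (2 * (x + 1) + 1))"
    using pos by (simp add: divide_simps) algebra
  then show ?case
    by (simp only: 1 2) (simp add: x_def algebra_simps)
qed simp

text \<open>If \<open>c\<close> is the limit, the Wallis product, expressed through Stirling ratios,
  tends to \<open>c^2 pi / 2\<close>. Its known limit \<open>pi / 2\<close> forces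
  \<open>c^2 = 1\<close>, and \<open>c > 0\<close> selects the root.\<close>

lemma stirling_ratio_tendsto: "stirling_ratio \<longlonglongrightarrow> 1"
proof -
  obtain c where c: "c > 0" "stirling_ratio \<longlonglongrightarrow> c"
    using stirling_ratio_convergent by blast
  have "(\<lambda>n. stirling_ratio (2 * n)) \<longlonglongrightarrow> c"
    using filterlim_compose[OF c(2), of "\<lambda>n. 2 * n" sequentially]
    by (simp add: mult_nat_left_at_top)
  then have "(\<lambda>n. stirling_ratio n ^ 4 / stirling_ratio (2 * n) ^ 2 * (pi * real n / (2 * real n + 1)))
      \<longlonglongrightarrow> c ^ 4 / c ^ 2 * (pi / 2)"
    using c by (intro tendsto_mult[of _ _ _ "\<lambda>n. pi * real n / (2 * real n + 1)"]
      tendsto_divide[of "\<lambda>n. stirling_ratio n ^ 4"] tendsto_power) (simp_all, real_asymp)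
  moreover have "eventually (\<lambda>n. stirling_ratio n ^ 4 / stirling_ratio (2 * n) ^ 2 *
      (pi * real n / (2 * real n + 1)) = (\<Prod>k=1..n. (4 * real k ^ 2) / (4 * real k ^ 2 - 1))) sequentially"
    using eventually_gt_at_top[of 0]
  proof eventually_elim
    case (elim n)
    have p4: "x ^ 4 = (x\<^sup>2)\<^sup>2" for x :: real by simp
    have 1: "sqrt (2 * pi * real n) ^ 4 = (2 * pi * real n) ^ 2"
      "sqrt (2 * pi * real (2 * n)) ^ 2 = 4 * pi * real n"
      by (simp_all add: p4)
    have 2: "((real (2 * n) / exp 1) ^ (2 * n)) ^ 2 = 16 ^ n * ((real n / exp 1) ^ n) ^ 4"
    proof -
      have "((real (2 * n) / exp 1) ^ (2 * n)) ^ 2 = ((2 * (real n / exp 1)) ^ 4) ^ n"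
        by (simp flip: power_mult add: mult_ac)
      also have "(2 * (real n / exp 1)) ^ 4 = 16 * (real n / exp 1) ^ 4"
        by (simp only: power_mult_distrib) simp
      finally show ?thesis by (simp only: power_mult_distrib flip: power_mult) (simp add: mult_ac)
    qed
    have "stirling_ratio n ^ 4 / stirling_ratio (2 * n) ^ 2 =
        fact n ^ 4 / ((2 * pi * real n) ^ 2 * ((real n / exp 1) ^ n) ^ 4) *
        (4 * pi * real n * (16 ^ n * ((real n / exp 1) ^ n) ^ 4) / fact (2 * n) ^ 2)"
      unfolding stirling_ratio_def power_divide[of _ "_ * _"] power_mult_distrib[of "sqrt _"] 1 2
      by simp
    also have "\<dots> = 16 ^ n * fact n ^ 4 / (pi * real n * fact (2 * n) ^ 2)"
      using elim by (simp add: divide_simps power2_eq_square del: power_divide)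
    finally show ?case
      unfolding wallis_product_eq using elim by simp
  qed
  ultimately have "(\<lambda>n. \<Prod>k=1..n. (4 * real k ^ 2) / (4 * real k ^ 2 - 1)) \<longlonglongrightarrow> c ^ 4 / c ^ 2 * (pi / 2)"
    by (rule Lim_transform_eventually)
  from LIMSEQ_unique[OF this wallis] have "c ^ 2 = 1"
    using c by (simp add: field_simps power2_eq_square power4_eq_xxxx)
  then show ?thesis
    using c by (simp add: power2_eq_1_iff)
qed

subsection \<open>Binomial probabilities and geometric series\<close>

definition binom_pt :: "nat \<Rightarrow> real \<Rightarrow> nat \<Rightarrow> real" where
  "binom_pt n p j = real (n choose j) * p ^ j * (1 - p) ^ (n - j)"

text \<open>Since \<open>m + (n - m) = n\<close>, the powers of \<open>e\<close> in the three
  factorials cancel, and the remaining powers combine with those of \<open>p\<close> and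
  \<open>1 - p\<close> to the entropy factor. The identity is exact and is checked on
  logarithms.\<close>

lemma binom_pt_stirling:
  assumes "0 < p" "p < 1" "0 < m" "m < n"
  shows "binom_pt n p m =
    stirling_ratio n / (stirling_ratio m * stirling_ratio (n - m)) *
    (sqrt (real n) / sqrt (2 * pi * real m * (real n - real m)) *
      exp (- real n * rel_entropy (real m / real n) p))"
proof -
  define r where "r = n - m"
  have r: "n - m = r" "r > 0" "real n - real m = real r" "n > 0" "real n = real m + real r"
    using assms by (auto simp: r_def)
  have pos: "binom_pt n p m > 0"
    using assms by (simp add: binom_pt_def)
  have fr: "1 - real m / real n = real r / real n"
    using r by (simp add: field_simps)
  have "ln (real (n choose m)) = ln (fact n) - ln (fact m) - ln (fact r)"
    using assms r by (simp add: binomial_fact ln_div ln_mult)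
  then have "ln (binom_pt n p m) =
      ln (fact n) - ln (fact m) - ln (fact r) + real m * ln p + real r * ln (1 - p)"
    using assms r unfolding binom_pt_def by (simp add: ln_mult ln_realpow)
  also have "\<dots> = ln (stirling_ratio n / (stirling_ratio m * stirling_ratio r) *
    (sqrt (real n) / sqrt (2 * pi * real m * real r) *
      exp (- real n * rel_entropy (real m / real n) p)))"
  proof -
    have "real n * rel_entropy (real m / real n) p =
       real m * ln (real m / real n / p) + real r * ln (real r / real n / (1 - p))"
      unfolding rel_entropy_def fr using r by (simp add: distrib_left)
    also have "ln (real m / real n / p) = ln (real m) - ln (real n) - ln p"
      using assms r by (subst ln_div; simp add: ln_div)
    also have "ln (real r / real n / (1 - p)) = ln (real r) - ln (real n) - ln (1 - p)"
      using assms r by (subst ln_div; simp add: ln_div)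
    finally have E: "real n * rel_entropy (real m / real n) p =
        real m * (ln (real m) - ln (real n) - ln p) + real r * (ln (real r) - ln (real n) - ln (1 - p))" .
    have "ln (stirling_ratio n / (stirling_ratio m * stirling_ratio r) *
    (sqrt (real n) / sqrt (2 * pi * real m * real r) *
      exp (- real n * rel_entropy (real m / real n) p))) =
      ln (stirling_ratio n) - ln (stirling_ratio m) - ln (stirling_ratio r)
      + ln (real n) / 2 - (ln (2 * pi) + ln (real m) + ln (real r)) / 2 - real n * rel_entropy (real m / real n) p"
      using assms r(1-4) stirling_ratio_pos[of n] stirling_ratio_pos[of m] stirling_ratio_pos[of r]
      by (simp add: ln_mult ln_div ln_sqrt)
    then show ?thesis
      using assms r(2,4) unfolding E by (simp add: ln_stirling_ratio r(5) algebra_simps add_divide_distrib)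
  qed
  finally show ?thesis
    using assms r pos stirling_ratio_pos[of n] stirling_ratio_pos[of m] stirling_ratio_pos[of r]
    by (subst (asm) ln_inj_iff) (auto intro!: mult_pos_pos divide_pos_pos)
qed

lemma binom_pt_nonneg: "0 \<le> p \<Longrightarrow> p \<le> 1 \<Longrightarrow> binom_pt n p j \<ge> 0"
  by (simp add: binom_pt_def)

lemma binom_pt_pos: "0 < p \<Longrightarrow> p < 1 \<Longrightarrow> j \<le> n \<Longrightarrow> binom_pt n p j > 0"
  by (simp add: binom_pt_def)

text \<open>The factor increases with \<open>j\<close>, so the ratios of successive terms shrink
  when moving down from \<open>m\<close>; both geometric comparisons rest on this.\<close>

lemma binom_pt_step:
  assumes "0 < p" "p < 1" "j < n"
  shows "binom_pt n p j = binom_pt n p (Suc j) * (real (Suc j) * (1 - p) / (real (n - j) * p))"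
proof -
  define J N where "J = real (Suc j)" and "N = real (n - j)"
  have pos: "N > 0" using assms by (simp add: N_def)
  have "Suc j * (n choose Suc j) = (n - j) * (n choose j)"
    by (metis binomial_absorb_comp binomial_absorption mult.commute)
  then have "J * real (n choose Suc j) = N * real (n choose j)"
    unfolding J_def N_def by (metis of_nat_mult)
  then have C: "real (n choose j) = real (n choose Suc j) * (J / N)"
    using pos by (simp add: field_simps)
  have Q: "(1 - p) ^ (n - j) = (1 - p) * (1 - p) ^ (n - Suc j)"
    using assms by (simp flip: power_Suc add: Suc_diff_Suc)
  show ?thesis
    unfolding binom_pt_def C Q J_def[symmetric] N_def[symmetric]
    using assms pos by simp
qed

text \<open>The first ratio below \<open>m\<close> is the largest one, so its power dominates the
  product of the first \<open>i\<close> ratios.\<close>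

lemma binom_pt_upper:
  assumes "0 < p" "p < 1" "m \<le> n" "i \<le> m"
  shows "binom_pt n p (m - i) \<le>
    binom_pt n p m * (real m * (1 - p) / ((real n - real m + 1) * p)) ^ i"
  using assms(4)
proof (induction i)
  case (Suc i)
  let ?r = "real m * (1 - p) / ((real n - real m + 1) * p)"
  have "binom_pt n p (m - Suc i) = binom_pt n p (m - i) *
      (real (m - i) * (1 - p) / (real (n - (m - Suc i)) * p))"
    using binom_pt_step[of p "m - Suc i" n] Suc.prems assms by (simp add: Suc_diff_Suc)
  also have "\<dots> \<le> binom_pt n p (m - i) * ?r"
    using assms Suc.prems
    by (intro mult_left_mono frac_le mult_right_mono binom_pt_nonneg) (auto simp: of_nat_diff)
  also have "\<dots> \<le> (binom_pt n p m * ?r ^ i) * ?r"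
    using Suc assms by (intro mult_right_mono) auto
  finally show ?case by (simp add: mult_ac)
qed simp

text \<open>The first \<open>s\<close> ratios have numerators with at least \<open>m - s + 1\<close>
  and denominators with at most \<open>n - m + s\<close>. Taking \<open>m - s\<close> in the
  numerator gives a slightly smaller ratio with a convenient complement
  \<open>1 - r\<close>.\<close>

lemma binom_pt_lower:
  assumes "0 < p" "p < 1" "m \<le> n" "s \<le> m" "i \<le> s"
  shows "binom_pt n p m * ((real m - real s) * (1 - p) / ((real n - real m + real s) * p)) ^ i
    \<le> binom_pt n p (m - i)"
  using assms(5)
proof (induction i)
  case (Suc i)
  let ?r = "(real m - real s) * (1 - p) / ((real n - real m + real s) * p)"
  have "binom_pt n p m * ?r ^ i * ?r \<le> binom_pt n p (m - i) * ?r"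
    using Suc assms by (intro mult_right_mono) auto
  also have "\<dots> \<le> binom_pt n p (m - i) *
      (real (m - i) * (1 - p) / (real (n - (m - Suc i)) * p))"
    using assms Suc.prems
    by (intro mult_left_mono frac_le mult_right_mono binom_pt_nonneg) (auto simp: of_nat_diff)
  also have "\<dots> = binom_pt n p (m - Suc i)"
    using binom_pt_step[of p "m - Suc i" n] Suc.prems assms by (simp add: Suc_diff_Suc)
  finally show ?case by (simp add: mult_ac)
qed simp

lemma binom_cdf_eq: "binom_cdf n m p = (\<Sum>i\<le>m. binom_pt n p (m - i))"
  using sum.nat_diff_reindex[of "binom_pt n p" "Suc m"]
  by (simp add: binom_cdf_def binom_pt_def lessThan_Suc_atMost atMost_atLeast0)

text \<open>The full geometric series with the first ratio \<open>r\<close> has sum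
  \<open>1 / (1 - r)\<close>, which is exactly \<open>V\<close> at \<open>0\<close>.\<close>

lemma binom_cdf_upper:
  assumes "0 < p" "p < 1" "m \<le> n" "real m \<le> p * real n"
  shows "binom_cdf n m p \<le> binom_pt n p m * V n m p 0"
proof -
  define r where "r = real m * (1 - p) / ((real n - real m + 1) * p)"
  have pos: "real n - real m + 1 > 0" "p * real n - real m + p > 0"
    using assms by auto
  have r: "1 - r = (p * real n - real m + p) / ((real n - real m + 1) * p)"
  proof -
    have "1 - r = ((real n - real m + 1) * p - real m * (1 - p)) / ((real n - real m + 1) * p)"
      using pos assms by (simp add: r_def diff_divide_distrib)
    then show ?thesis by (simp add: algebra_simps)
  qed
  have "1 - r > 0"
    unfolding r using pos assms by (intro divide_pos_pos mult_pos_pos) auto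
  moreover have "0 \<le> r"
    using pos assms by (simp add: r_def)
  ultimately have r01: "0 \<le> r" "r < 1" by auto
  have "binom_cdf n m p \<le> (\<Sum>i\<le>m. binom_pt n p m * r ^ i)"
    unfolding binom_cdf_eq r_def using assms by (intro sum_mono binom_pt_upper) auto
  also have "\<dots> = binom_pt n p m * ((1 - r ^ Suc m) / (1 - r))"
    using r01 by (simp add: sum_gp0 flip: sum_distrib_left)
  also have "\<dots> \<le> binom_pt n p m * (1 / (1 - r))"
    using r01 assms by (intro mult_left_mono divide_right_mono binom_pt_nonneg) auto
  also have "1 / (1 - r) = V n m p 0"
    unfolding r V_def using pos assms by (simp add: add_ac diff_add_eq algebra_simps)
  finally show ?thesis .
qed

text \<open>Only the terms \<open>i \<le> s\<close> are kept and bounded below by a geometric sum.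
  Its ratio is \<open>1 - d\<close>, and \<open>1 - d \<le> exp (- d)\<close> controls the
  truncation error.\<close>

lemma binom_cdf_lower:
  assumes "0 < p" "p < 1" "m < n" "s \<le> m" "real m < p * real n"
  defines "d \<equiv> (p * real n - real m + real s) / (p * (real n - real m + real s))"
  shows "binom_pt n p m * ((1 - exp (- d * real s)) / d) \<le> binom_cdf n m p"
proof -
  define r where "r = (real m - real s) * (1 - p) / ((real n - real m + real s) * p)"
  have pos: "real n - real m + real s > 0" "p * real n - real m + real s > 0"
    using assms by auto
  have r: "1 - r = d"
  proof -
    have "1 - r = ((real n - real m + real s) * p - (real m - real s) * (1 - p)) /
        ((real n - real m + real s) * p)"
      using pos assms by (simp add: r_def diff_divide_distrib)
    then show ?thesis by (simp add: d_def algebra_simps)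
  qed
  have d: "d > 0"
    using pos assms by (simp add: d_def)
  have r0: "0 \<le> r"
    using pos assms by (simp add: r_def)
  \<comment> \<open>One factor \<open>r \<le> 1\<close> is given up so that the exponent becomes
    \<open>- d * s\<close>.\<close>
  have "r ^ Suc s \<le> r ^ s"
    using r d r0 by (simp add: mult_left_le_one_le)
  also have "\<dots> \<le> exp (- d) ^ s"
    using r r0 exp_ge_add_one_self[of "- d"] by (intro power_mono) auto
  also have "\<dots> = exp (- d * real s)"
    by (simp add: exp_of_nat_mult[symmetric] mult.commute)
  finally have "binom_pt n p m * ((1 - exp (- d * real s)) / d) \<le> binom_pt n p m * ((1 - r ^ Suc s) / (1 - r))"
    unfolding r using assms(1-2) d
    by (intro mult_left_mono divide_right_mono binom_pt_nonneg) simp_all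
  also have "\<dots> = (\<Sum>i\<le>s. binom_pt n p m * r ^ i)"
    using r d by (simp add: sum_gp0 flip: sum_distrib_left)
  also have "\<dots> \<le> (\<Sum>i\<le>s. binom_pt n p (m - i))"
    unfolding r_def using assms by (intro sum_mono binom_pt_lower) auto
  also have "\<dots> \<le> binom_cdf n m p"
    unfolding binom_cdf_eq using assms by (intro sum_mono2 binom_pt_nonneg) auto
  finally show ?thesis .
qed

text \<open>With \<open>c\<close> and \<open>N\<close> as in the proof, the increase of
  \<open>b + N / (c + b)\<close> over \<open>N / c\<close> is
  \<open>b (1 - N / (c (c + b)))\<close>, which is nonnegative once
  \<open>N \<le> c^2\<close>.\<close>

lemma U_eq_V_0:
  assumes "0 < p" "p < 1" "m \<le> n" "real m \<le> p * real n"
    and "p * (real n - real m + 1) \<le> (p * real n + p - real m)\<^sup>2"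
  shows "U n m p = V n m p 0"
proof -
  define c where "c = p * real n + p - real m"
  define N where "N = p * (real n - real m + 1)"
  have c: "c > 0" and N: "N \<ge> 0" "N \<le> c\<^sup>2"
    using assms by (auto simp: c_def N_def)
  have "V n m p 0 \<le> V n m p b" for b
  proof -
    have "N / c \<le> real b + N / (c + real b)"
    proof -
      have "N * real b \<le> c\<^sup>2 * real b" using N by (intro mult_right_mono) auto
      also have "\<dots> \<le> real b * c * (c + real b)"
        using c by (simp add: power2_eq_square algebra_simps)
      finally show ?thesis using c by (simp add: field_simps)
    qed
    also have "\<dots> \<le> real b + (N + p * real b) / (c + real b)"
      using c assms by (intro add_left_mono divide_right_mono) auto
    finally show ?thesis
      by (simp add: V_def c_def N_def algebra_simps)
  qed
  then show ?thesis
    unfolding U_def by (intro cInf_eq_minimum) auto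
qed

subsection \<open>Relative entropy near its zero\<close>

text \<open>The derivative is continuous and vanishes at \<open>p\<close>, so it is at most
  \<open>e\<close> in absolute value on a small ball; the mean value inequality turns this into a
  Lipschitz bound.\<close>

lemma rel_entropy_strict_derivative:
  assumes "0 < p" "p < 1" "e > 0"
  shows "\<exists>\<delta>>0. \<forall>x y. \<bar>x - p\<bar> < \<delta> \<longrightarrow> \<bar>y - p\<bar> < \<delta> \<longrightarrow>
    \<bar>rel_entropy x p - rel_entropy y p\<bar> \<le> e * \<bar>x - y\<bar>"
proof -
  define D where "D x = ln (x / p) - ln ((1 - x) / (1 - p))" for x
  have deriv: "((\<lambda>x. rel_entropy x p) has_field_derivative D x) (at x)" if "0 < x" "x < 1" for x
  proof -
    have "((\<lambda>x. x * ln (x / p)) has_field_derivative ln (x / p) + 1) (at x)"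
      using that assms by (auto intro!: derivative_eq_intros)
    moreover have "((\<lambda>x. (1 - x) * ln ((1 - x) / (1 - p))) has_field_derivative
        - ln ((1 - x) / (1 - p)) - 1) (at x)"
      using that assms by (auto intro!: derivative_eq_intros simp: divide_simps) (simp add: algebra_simps)
    ultimately show ?thesis
      unfolding rel_entropy_def D_def by (auto dest: DERIV_add)
  qed
  have "(D \<longlongrightarrow> ln (p / p) - ln ((1 - p) / (1 - p))) (at p)"
    unfolding D_def using assms by (intro tendsto_intros) auto
  then have "(D \<longlongrightarrow> 0) (at p)" using assms by simp
  then obtain d where d: "d > 0" "\<And>x. x \<noteq> p \<Longrightarrow> dist x p < d \<Longrightarrow> \<bar>D x\<bar> < e"
    using assms unfolding tendsto_iff eventually_at by (auto simp: dist_real_def)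
  \<comment> \<open>The limit says nothing about the point \<open>p\<close> itself, where
    \<open>D\<close> is \<open>0\<close> by its formula.\<close>
  have D: "\<bar>D x\<bar> \<le> e" if "dist x p < d" for x
    using d(2)[of x] that assms by (cases "x = p") (auto simp: D_def)
  \<comment> \<open>The ball of this radius also stays inside the unit interval, where the
    derivative formula holds.\<close>
  define \<delta> where "\<delta> = min d (min p (1 - p))"
  have "\<bar>rel_entropy x p - rel_entropy y p\<bar> \<le> e * \<bar>x - y\<bar>" if "\<bar>x - p\<bar> < \<delta>" "\<bar>y - p\<bar> < \<delta>" for x y
  proof -
    have "norm (rel_entropy x p - rel_entropy y p) \<le> e * norm (x - y)"
    proof (rule field_differentiable_bound[of "ball p \<delta>" "\<lambda>x. rel_entropy x p" D])
      show "((\<lambda>x. rel_entropy x p) has_field_derivative D z) (at z within ball p \<delta>)" if "z \<in> ball p \<delta>" for z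
        using that by (intro DERIV_subset[OF deriv]) (auto simp: \<delta>_def dist_real_def)
      show "norm (D z) \<le> e" if "z \<in> ball p \<delta>" for z
        using that D[of z] by (simp add: \<delta>_def dist_commute)
    qed (use that in \<open>auto simp: dist_real_def\<close>)
    then show ?thesis by simp
  qed
  then show ?thesis
    using d assms by (intro exI[of _ \<delta>]) (auto simp: \<delta>_def)
qed

text \<open>The arguments differ by \<open>O(1/n)\<close> and the Lipschitz constant near
  \<open>p\<close> can be made arbitrarily small, which beats the factor \<open>n\<close>.\<close>

lemma rel_entropy_diff_tendsto:
  assumes "0 < p" "p < 1" "x \<longlonglongrightarrow> p" "y \<longlonglongrightarrow> p"
    and "eventually (\<lambda>n. real n * \<bar>x n - y n\<bar> \<le> C) sequentially"
  shows "(\<lambda>n. real n * (rel_entropy (x n) p - rel_entropy (y n) p)) \<longlonglongrightarrow> 0"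
proof (rule tendstoI)
  fix e :: real assume "e > 0"
  \<comment> \<open>The denominator \<open>\<bar>C\<bar> + 1\<close> is positive whatever the sign
    of \<open>C\<close>.\<close>
  define e' where "e' = e / (\<bar>C\<bar> + 1)"
  have e': "e' > 0" "e' * C < e"
  proof -
    show "e' > 0" using \<open>e > 0\<close> by (simp add: e'_def)
    then have "e' * C \<le> e' * \<bar>C\<bar>" by (intro mult_left_mono) auto
    also have "\<dots> < e' * (\<bar>C\<bar> + 1)" using \<open>e' > 0\<close> by simp
    also have "\<dots> = e" by (simp add: e'_def)
    finally show "e' * C < e" .
  qed
  obtain \<delta> where \<delta>: "\<delta> > 0" "\<And>x y. \<bar>x - p\<bar> < \<delta> \<Longrightarrow> \<bar>y - p\<bar> < \<delta> \<Longrightarrow>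
      \<bar>rel_entropy x p - rel_entropy y p\<bar> \<le> e' * \<bar>x - y\<bar>"
    using rel_entropy_strict_derivative[OF assms(1,2) e'(1)] by blast
  have "eventually (\<lambda>n. \<bar>x n - p\<bar> < \<delta>) sequentially" "eventually (\<lambda>n. \<bar>y n - p\<bar> < \<delta>) sequentially"
    using tendstoD[OF assms(3) \<delta>(1)] tendstoD[OF assms(4) \<delta>(1)] by (simp_all add: dist_real_def)
  with assms(5) show "eventually (\<lambda>n. dist (real n * (rel_entropy (x n) p - rel_entropy (y n) p)) 0 < e) sequentially"
  proof eventually_elim
    case (elim n)
    have "real n * \<bar>rel_entropy (x n) p - rel_entropy (y n) p\<bar> \<le> real n * (e' * \<bar>x n - y n\<bar>)"
      using \<delta>(2)[OF elim(2,3)] by (intro mult_left_mono) auto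
    also have "\<dots> = e' * (real n * \<bar>x n - y n\<bar>)" by simp
    also have "\<dots> \<le> e' * C" using elim(1) e' by (intro mult_left_mono) auto
    finally show ?case using e' by (simp add: dist_real_def abs_mult)
  qed
qed

subsection \<open>Moderate deviations\<close>

text \<open>The setting for an integer sequence \<open>m\<close> lying \<open>a\<close> below the
  mean. Rounding is thus treated only once, when \<open>m\<close> is specialised to the
  floor.\<close>

locale moderate_lower_tail =
  fixes p :: real and m :: "nat \<Rightarrow> nat" and a :: "nat \<Rightarrow> real"
  assumes p01: "0 < p" "p < 1"
    and a_eq: "\<And>n. a n = p * real n - real (m n)"
    and a_small: "(\<lambda>n. a n / real n) \<longlonglongrightarrow> 0"
    and a_large: "filterlim (\<lambda>n. a n / sqrt (real n)) at_top sequentially"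
begin

section \<open>Growth of \<open>m\<close> and \<open>a\<close>\<close>

lemma ratio_tendsto: "(\<lambda>n. real (m n) / real n) \<longlonglongrightarrow> p"
proof -
  have "(\<lambda>n. p - a n / real n) \<longlonglongrightarrow> p - 0"
    by (intro tendsto_intros a_small)
  moreover have "eventually (\<lambda>n. p - a n / real n = real (m n) / real n) sequentially"
    using eventually_gt_at_top[of 0] by eventually_elim (simp add: a_eq field_simps)
  ultimately show ?thesis by (simp add: tendsto_cong)
qed

lemma a_at_top: "filterlim a at_top sequentially"
proof -
  have "filterlim (\<lambda>n. a n / sqrt (real n) * sqrt (real n)) at_top sequentially"
    by (intro filterlim_at_top_mult_at_top a_large) real_asymp
  moreover have "eventually (\<lambda>n. a n / sqrt (real n) * sqrt (real n) = a n) sequentially"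
    using eventually_gt_at_top[of 0] by eventually_elim simp
  ultimately show ?thesis by (simp cong: filterlim_cong)
qed

lemma eventually_range: "eventually (\<lambda>n. 0 < m n \<and> m n < n \<and> 0 < a n \<and> 0 < n) sequentially"
proof -
  have "eventually (\<lambda>n. real (m n) / real n > 0) sequentially"
    using order_tendstoD(1)[OF ratio_tendsto] p01 by blast
  moreover have "eventually (\<lambda>n. real (m n) / real n < 1) sequentially"
    using order_tendstoD(2)[OF ratio_tendsto] p01 by blast
  moreover have "eventually (\<lambda>n. a n > 0) sequentially"
    using a_at_top by (simp add: filterlim_at_top_dense)
  ultimately show ?thesis
    using eventually_gt_at_top[of 0] by eventually_elim (auto simp: zero_less_divide_iff)
qed

lemma inverse_a_tendsto: "(\<lambda>n. c / a n) \<longlonglongrightarrow> 0"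
  using a_at_top by (rule tendsto_divide_0[OF tendsto_const filterlim_at_top_imp_at_infinity])

lemma sqrt_over_a_tendsto: "(\<lambda>n. sqrt (real n) / a n) \<longlonglongrightarrow> 0"
  using tendsto_divide_0[OF tendsto_const filterlim_at_top_imp_at_infinity[OF a_large], of 1] by simp

lemma n_over_a_squared_tendsto: "(\<lambda>n. real n / (a n)\<^sup>2) \<longlonglongrightarrow> 0"
  using tendsto_power[OF sqrt_over_a_tendsto, of 2] by (simp add: power_divide)

section \<open>Asymptotics of \<open>L\<close>, of \<open>U\<close> and of the tail ratio\<close>

text \<open>In \<open>L = (1 - x + S) / 2\<close> the large terms \<open>S\<close> and
  \<open>x\<close> nearly cancel. Multiplying by the conjugate \<open>S + x - 1\<close> gives a
  quotient whose parts have limits after scaling.\<close>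

lemma L_asymp: "(\<lambda>n. L n (m n) p * (a n / real n)) \<longlonglongrightarrow> p * (1 - p)"
proof -
  have lim: "(\<lambda>n. (2 * (a n / real n) + 2 * (1 - p) * (real (m n) / real n)) /
      (sqrt ((1 + 1 / a n)\<^sup>2 + 4 * (1 - p) * (real (m n) / real n) * (real n / (a n)\<^sup>2)) + 1 - 1 / a n))
    \<longlonglongrightarrow> (2 * 0 + 2 * (1 - p) * p) / (sqrt ((1 + 0)\<^sup>2 + 4 * (1 - p) * p * 0) + 1 - 0)"
    by (intro tendsto_intros a_small ratio_tendsto inverse_a_tendsto n_over_a_squared_tendsto) simp
  have "eventually (\<lambda>n. (2 * (a n / real n) + 2 * (1 - p) * (real (m n) / real n)) /
      (sqrt ((1 + 1 / a n)\<^sup>2 + 4 * (1 - p) * (real (m n) / real n) * (real n / (a n)\<^sup>2)) + 1 - 1 / a n)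
      = L n (m n) p * (a n / real n)) sequentially"
    using eventually_range
  proof eventually_elim
    case (elim n)
    define x where "x = a n"
    define M where "M = real (m n)"
    define S where "S = sqrt ((x + 1)\<^sup>2 + 4 * (1 - p) * M)"
    have pos: "x > 0" "M > 0" "real n > 0" using elim by (auto simp: x_def M_def)
    have S2: "S\<^sup>2 = (x + 1)\<^sup>2 + 4 * (1 - p) * M"
      using pos p01 by (auto simp: S_def)
    have "(1 - x)\<^sup>2 < (x + 1)\<^sup>2"
      using pos by (simp add: power2_eq_square algebra_simps)
    moreover have "4 * (1 - p) * M > 0" using pos p01 by simp
    ultimately have "1 - x < S"
      unfolding S_def by (intro real_less_rsqrt) linarith
    then have Sx: "S + x - 1 > 0" by simp
    have "sqrt ((1 + 1 / x)\<^sup>2 + 4 * (1 - p) * (M / real n) * (real n / x\<^sup>2)) = S / x"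
    proof -
      have "(1 + 1 / x)\<^sup>2 + 4 * (1 - p) * (M / real n) * (real n / x\<^sup>2) = ((x + 1)\<^sup>2 + 4 * (1 - p) * M) / x\<^sup>2"
        using pos by (simp add: field_simps power2_eq_square)
      then show ?thesis using pos by (simp add: S_def real_sqrt_divide)
    qed
    moreover have "S / x + 1 - 1 / x = (S + x - 1) / x"
      using pos by (simp add: field_simps)
    moreover have "L n (m n) p = (2 * x + 2 * (1 - p) * M) / (S + x - 1)"
    proof -
      have "L n (m n) p = (1 - x + S) / 2"
        by (simp add: L_def S_def x_def M_def a_eq algebra_simps)
      then have "L n (m n) p * (S + x - 1) = (1 - x + S) * (S + x - 1) / 2"
        by simp
      \<comment> \<open>This is \<open>S^2 - (1 - x)^2\<close>, where
        \<open>(x + 1)^2 - (1 - x)^2 = 4 x\<close>.\<close>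
      also have "(1 - x + S) * (S + x - 1) = 2 * (2 * x + 2 * (1 - p) * M)"
        using S2 by (simp add: power2_eq_square algebra_simps)
      also have "\<dots> / 2 = 2 * x + 2 * (1 - p) * M"
        by simp
      finally have "L n (m n) p * (S + x - 1) = 2 * x + 2 * (1 - p) * M" .
      then show ?thesis using Sx by (simp add: nonzero_eq_divide_eq)
    qed
    moreover have "2 * (x / real n) + 2 * (1 - p) * (M / real n) = (2 * x + 2 * (1 - p) * M) / real n"
      by (simp add: add_divide_distrib)
    ultimately show ?case
      by (simp only: x_def[symmetric] M_def[symmetric]) simp
  qed
  from Lim_transform_eventually[OF lim this]
  have "(\<lambda>n. L n (m n) p * (a n / real n))
      \<longlonglongrightarrow> (2 * 0 + 2 * (1 - p) * p) / (sqrt ((1 + 0)\<^sup>2 + 4 * (1 - p) * p * 0) + 1 - 0)" .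
  also have "(2 * 0 + 2 * (1 - p) * p) / (sqrt ((1 + 0)\<^sup>2 + 4 * (1 - p) * p * 0) + 1 - 0) = p * (1 - p)"
    by simp
  finally show ?thesis .
qed

lemma V_0_asymp: "(\<lambda>n. V n (m n) p 0 * (a n / real n)) \<longlonglongrightarrow> p * (1 - p)"
proof -
  have lim: "(\<lambda>n. p * (1 - real (m n) / real n + 1 / real n) / (1 + p / a n)) \<longlonglongrightarrow> p * (1 - p + 0) / (1 + 0)"
    by (intro tendsto_intros ratio_tendsto inverse_a_tendsto lim_1_over_n) simp
  have "eventually (\<lambda>n. p * (1 - real (m n) / real n + 1 / real n) / (1 + p / a n)
      = V n (m n) p 0 * (a n / real n)) sequentially"
    using eventually_range
  proof eventually_elim
    case (elim n)
    have "V n (m n) p 0 = p * (real n - real (m n) + 1) / (a n + p)"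
      by (simp add: V_def a_eq algebra_simps)
    moreover have "1 + p / a n = (a n + p) / a n"
      "1 - real (m n) / real n + 1 / real n = (real n - real (m n) + 1) / real n"
      using elim by (simp_all add: field_simps)
    ultimately show ?case by simp
  qed
  with lim show ?thesis by (simp add: tendsto_cong)
qed

text \<open>As \<open>m \<ge> 1\<close> eventually, \<open>p (n - m + 1) \<le> n\<close>, and
  \<open>n \<le> a^2\<close> eventually, so the criterion of \<open>U_eq_V_0\<close>
  applies.\<close>

lemma eventually_U: "eventually (\<lambda>n. U n (m n) p = V n (m n) p 0) sequentially"
proof -
  have "eventually (\<lambda>n. real n / (a n)\<^sup>2 < 1) sequentially"
    using order_tendstoD(2)[OF n_over_a_squared_tendsto] by auto
  with eventually_range show ?thesis
  proof eventually_elim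
    case (elim n)
    have "p * (real n - real (m n) + 1) \<le> 1 * real n"
      using elim p01 by (intro mult_mono) auto
    also have "\<dots> \<le> (a n)\<^sup>2" using elim by (simp add: field_simps)
    also have "\<dots> \<le> (a n + p)\<^sup>2" using elim p01 by (intro power_mono) auto
    finally show ?case
      using elim p01 by (intro U_eq_V_0) (auto simp: a_eq algebra_simps)
  qed
qed

lemma U_asymp: "(\<lambda>n. U n (m n) p * (a n / real n)) \<longlonglongrightarrow> p * (1 - p)"
  using V_0_asymp
  by (rule Lim_transform_eventually) (use eventually_U in \<open>auto elim: eventually_mono\<close>)

text \<open>Squeezed between \<open>binom_cdf_lower\<close> and \<open>binom_cdf_upper\<close>,
  whose scaled bounds have the same limit.\<close>

lemma binom_cdf_asymp:
  "(\<lambda>n. binom_cdf n (m n) p / binom_pt n p (m n) * (a n / real n)) \<longlonglongrightarrow> p * (1 - p)"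
proof (rule tendsto_sandwich)
  \<comment> \<open>Any \<open>s\<close> with \<open>s / a \<rightarrow> 0\<close> and \<open>s a / n \<rightarrow> \<infinity>\<close> would do: the lower ratio \<open>1 - d\<close> then has the same
    asymptotic deficit as the upper one, and truncating the series after \<open>s\<close> terms is negligible.\<close>
  define s where "s n = nat \<lceil>sqrt (real n)\<rceil>" for n
  define d where "d n = (p * real n - real (m n) + real (s n)) / (p * (real n - real (m n) + real (s n)))" for n
  have s_ge: "real (s n) \<ge> sqrt (real n)" for n
    by (simp add: s_def)
  have s_le: "real (s n) \<le> sqrt (real n) + 1" for n
    using real_sqrt_ge_zero[of "real n"] unfolding s_def by linarith
  have s_n: "(\<lambda>n. real (s n) / real n) \<longlonglongrightarrow> 0"
  proof (rule tendsto_sandwich[of "\<lambda>_. 0"])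
    show "eventually (\<lambda>n. real (s n) / real n \<le> (sqrt (real n) + 1) / real n) sequentially"
      using s_le by (intro always_eventually allI divide_right_mono) auto
    show "(\<lambda>n. (sqrt (real n) + 1) / real n) \<longlonglongrightarrow> 0" by real_asymp
  qed (auto intro: tendsto_const)
  have s_a: "(\<lambda>n. real (s n) / a n) \<longlonglongrightarrow> 0"
  proof (rule tendsto_sandwich[of "\<lambda>_. 0"])
    show "eventually (\<lambda>n. real (s n) / a n \<le> sqrt (real n) / a n + 1 / a n) sequentially"
      using eventually_range
      by eventually_elim (use s_le in \<open>auto simp flip: add_divide_distrib intro!: divide_right_mono\<close>)
    show "(\<lambda>n. sqrt (real n) / a n + 1 / a n) \<longlonglongrightarrow> 0"
      using tendsto_add[OF sqrt_over_a_tendsto inverse_a_tendsto] by simp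
    show "eventually (\<lambda>n. 0 \<le> real (s n) / a n) sequentially"
      using eventually_range by eventually_elim simp
  qed simp
  have "(\<lambda>n. real (m n) / real n - real (s n) / real n) \<longlonglongrightarrow> p - 0"
    by (intro tendsto_intros ratio_tendsto s_n)
  then have "eventually (\<lambda>n. real (m n) / real n - real (s n) / real n > 0) sequentially"
    using p01 by (auto dest: order_tendstoD)
  then have s_m: "eventually (\<lambda>n. s n < m n) sequentially"
    using eventually_range by eventually_elim (auto simp: divide_less_cancel)
  \<comment> \<open>From \<open>s < m\<close> the denominator of \<open>d\<close> is at most
    \<open>n\<close>, so \<open>d \<ge> a / n\<close>; with \<open>s \<ge> sqrt n\<close> this gives
    \<open>d s \<ge> a / sqrt n\<close>.\<close>
  have ds: "filterlim (\<lambda>n. d n * real (s n)) at_top sequentially"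
    using a_large
  proof (rule filterlim_at_top_mono)
    show "eventually (\<lambda>n. a n / sqrt (real n) \<le> d n * real (s n)) sequentially"
      using eventually_range s_m
    proof eventually_elim
      case (elim n)
      have "a n / real n \<le> d n"
        unfolding d_def
      proof (rule frac_le)
        have "p * (real n - real (m n) + real (s n)) \<le> 1 * real n"
          using elim p01 by (intro mult_mono) auto
        then show "p * (real n - real (m n) + real (s n)) \<le> real n" by simp
      qed (use elim p01 in \<open>auto simp: a_eq\<close>)
      moreover have "0 \<le> a n / real n" using elim by simp
      ultimately have "a n / real n * sqrt (real n) \<le> d n * real (s n)"
        using s_ge[of n] by (intro mult_mono) simp_all
      moreover have "a n / real n * sqrt (real n) = a n / sqrt (real n)"
        using sqrt_divide_self_eq[of "real n"] by (simp add: divide_inverse mult_ac)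
      ultimately show ?case by simp
    qed
  qed
  have E: "(\<lambda>n. exp (- d n * real (s n))) \<longlonglongrightarrow> 0"
    using filterlim_compose[OF exp_at_bot] ds by (simp add: filterlim_uminus_at_top)
  \<comment> \<open>The second factor is \<open>a / (n d)\<close>, rearranged so that each of its
    parts has a limit.\<close>
  have lim: "(\<lambda>n. (1 - exp (- d n * real (s n))) *
      (p * (1 - real (m n) / real n + real (s n) / real n) / (1 + real (s n) / a n)))
      \<longlonglongrightarrow> (1 - 0) * (p * (1 - p + 0) / (1 + 0))"
    by (intro tendsto_intros E ratio_tendsto s_n s_a) simp
  show "(\<lambda>n. (1 - exp (- d n * real (s n))) *
      (p * (1 - real (m n) / real n + real (s n) / real n) / (1 + real (s n) / a n)))
      \<longlonglongrightarrow> p * (1 - p)"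
    using lim by simp
  show "eventually (\<lambda>n. (1 - exp (- d n * real (s n))) *
      (p * (1 - real (m n) / real n + real (s n) / real n) / (1 + real (s n) / a n))
      \<le> binom_cdf n (m n) p / binom_pt n p (m n) * (a n / real n)) sequentially"
    using eventually_range s_m
  proof eventually_elim
    case (elim n)
    have "binom_pt n p (m n) * ((1 - exp (- d n * real (s n))) / d n) \<le> binom_cdf n (m n) p"
      unfolding d_def using elim p01 by (intro binom_cdf_lower) (auto simp: a_eq)
    then have "(1 - exp (- d n * real (s n))) / d n \<le> binom_cdf n (m n) p / binom_pt n p (m n)"
      using binom_pt_pos[of p "m n" n] elim p01 by (simp add: pos_le_divide_eq mult.commute)
    then have "(1 - exp (- d n * real (s n))) / d n * (a n / real n) \<le>
        binom_cdf n (m n) p / binom_pt n p (m n) * (a n / real n)"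
      using elim by (intro mult_right_mono) auto
    moreover have "d n = (a n + real (s n)) / (p * (real n - real (m n) + real (s n)))"
      by (simp add: d_def a_eq)
    moreover have "1 + real (s n) / a n = (a n + real (s n)) / a n"
      "1 - real (m n) / real n + real (s n) / real n = (real n - real (m n) + real (s n)) / real n"
      using elim by (simp_all add: field_simps)
    ultimately show ?case by (simp add: mult_ac)
  qed
  show "eventually (\<lambda>n. binom_cdf n (m n) p / binom_pt n p (m n) * (a n / real n)
      \<le> V n (m n) p 0 * (a n / real n)) sequentially"
    using eventually_range
  proof eventually_elim
    case (elim n)
    have "binom_cdf n (m n) p \<le> binom_pt n p (m n) * V n (m n) p 0"
      using elim p01 by (intro binom_cdf_upper) (auto simp: a_eq)
    then show ?case
      using elim binom_pt_pos[of p "m n" n] p01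
      by (intro mult_right_mono) (auto simp: pos_divide_le_eq mult.commute)
  qed
qed (rule V_0_asymp)

section \<open>The three limits along an integer sequence\<close>

lemma m_at_top: "filterlim m at_top sequentially"
  and n_minus_m_at_top: "filterlim (\<lambda>n. n - m n) at_top sequentially"
proof -
  have "filterlim (\<lambda>n. real (m n) / real n * real n) at_top sequentially"
    using p01 by (intro filterlim_tendsto_pos_mult_at_top[OF ratio_tendsto]) (auto intro: filterlim_real_sequentially)
  moreover have "eventually (\<lambda>n. real (m n) / real n * real n = real (m n)) sequentially"
    using eventually_gt_at_top[of 0] by eventually_elim simp
  ultimately have "filterlim (\<lambda>n. real (m n)) at_top sequentially"
    by (simp cong: filterlim_cong)
  then show "filterlim m at_top sequentially"
    by (simp add: filterlim_sequentially_iff_filterlim_real)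
  have "filterlim (\<lambda>n. (1 - real (m n) / real n) * real n) at_top sequentially"
    using p01 by (intro filterlim_tendsto_pos_mult_at_top[OF tendsto_diff[OF tendsto_const ratio_tendsto]])
      (auto intro: filterlim_real_sequentially)
  moreover have "eventually (\<lambda>n. (1 - real (m n) / real n) * real n = real (n - m n)) sequentially"
    using eventually_range by eventually_elim (simp add: of_nat_diff field_simps)
  ultimately have "filterlim (\<lambda>n. real (n - m n)) at_top sequentially"
    by (simp cong: filterlim_cong)
  then show "filterlim (\<lambda>n. n - m n) at_top sequentially"
    by (simp add: filterlim_sequentially_iff_filterlim_real)
qed

text \<open>Common final step for all three quantities: \<open>X\<close> is \<open>L\<close>,
  \<open>U\<close> or the tail ratio, and \<open>Y\<close> collects the corrections. The
  exponentials cancel, and what is left is \<open>X a / n\<close> over a square root tending to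
  \<open>sqrt (2 pi p (1 - p))\<close>.\<close>

lemma scaled_tendsto:
  assumes "(\<lambda>n. X n * (a n / real n)) \<longlonglongrightarrow> p * (1 - p)" "Y \<longlonglongrightarrow> 1"
  shows "(\<lambda>n. X n * (sqrt (real n) / sqrt (2 * pi * real (m n) * (real n - real (m n)))
      * exp (- real n * rel_entropy (real (m n) / real n) p)) * Y n * (a n / sqrt (real n))
      * exp (real n * rel_entropy (real (m n) / real n) p)) \<longlonglongrightarrow> sqrt (p * (1 - p) / (2 * pi))"
proof -
  have "(\<lambda>n. X n * (a n / real n) * (1 / sqrt (2 * pi * (real (m n) / real n) * (1 - real (m n) / real n))) * Y n)
      \<longlonglongrightarrow> p * (1 - p) * (1 / sqrt (2 * pi * p * (1 - p))) * 1"
    using p01 by (intro tendsto_intros assms ratio_tendsto) auto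
  moreover have "p * (1 - p) * (1 / sqrt (2 * pi * p * (1 - p))) * 1 = sqrt (p * (1 - p) / (2 * pi))"
  proof -
    have "sqrt (2 * pi * p * (1 - p)) = sqrt (p * (1 - p)) * sqrt (2 * pi)"
      by (simp flip: real_sqrt_mult add: mult_ac)
    then have "p * (1 - p) / sqrt (2 * pi * p * (1 - p)) = p * (1 - p) / sqrt (p * (1 - p)) / sqrt (2 * pi)"
      by simp
    also have "\<dots> = sqrt (p * (1 - p)) / sqrt (2 * pi)"
      using p01 by (subst real_div_sqrt) auto
    finally have "p * (1 - p) / sqrt (2 * pi * p * (1 - p)) = sqrt (p * (1 - p)) / sqrt (2 * pi)" .
    then show ?thesis by (simp add: real_sqrt_divide)
  qed
  moreover have "eventually (\<lambda>n. X n * (a n / real n) * (1 / sqrt (2 * pi * (real (m n) / real n) * (1 - real (m n) / real n))) * Y n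
    = X n * (sqrt (real n) / sqrt (2 * pi * real (m n) * (real n - real (m n)))
      * exp (- real n * rel_entropy (real (m n) / real n) p)) * Y n * (a n / sqrt (real n))
      * exp (real n * rel_entropy (real (m n) / real n) p)) sequentially"
    using eventually_range
  proof eventually_elim
    case (elim n)
    have "2 * pi * (real (m n) / real n) * (1 - real (m n) / real n) =
        2 * pi * real (m n) * (real n - real (m n)) / (real n)\<^sup>2"
      using elim by (simp add: field_simps power2_eq_square)
    then have "1 / sqrt (2 * pi * (real (m n) / real n) * (1 - real (m n) / real n)) =
        real n / sqrt (2 * pi * real (m n) * (real n - real (m n)))"
      using elim by (simp add: real_sqrt_divide)
    then show ?case
      using elim by (simp add: exp_minus)
  qed
  ultimately show ?thesis
    by (simp add: Lim_transform_eventually)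
qed

lemma B_down_asymp: "(\<lambda>n. B_down n (m n) p * (a n / sqrt (real n))
    * exp (real n * rel_entropy (real (m n) / real n) p)) \<longlonglongrightarrow> sqrt (p * (1 - p) / (2 * pi))"
proof -
  \<comment> \<open>Natural subtraction, which agrees with the real difference once
    \<open>m n < n\<close>, makes \<open>n_minus_m_at_top\<close> applicable.\<close>
  have "(\<lambda>n. exp (1 / (12 * real n) - 1 / (12 * real (m n)) - 1 / (12 * real (n - m n)))) \<longlonglongrightarrow> exp (0 - 0 - 0)"
  proof (intro tendsto_intros)
    show *: "(\<lambda>n::nat. 1 / (12 * real n)) \<longlonglongrightarrow> 0" by real_asymp
    show "(\<lambda>n. 1 / (12 * real (m n))) \<longlonglongrightarrow> 0" by (rule filterlim_compose[OF * m_at_top])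
    show "(\<lambda>n. 1 / (12 * real (n - m n))) \<longlonglongrightarrow> 0" by (rule filterlim_compose[OF * n_minus_m_at_top])
  qed
  then have "(\<lambda>n. exp (1 / (12 * real n) - 1 / (12 * real (m n)) - 1 / (12 * real (n - m n)))) \<longlonglongrightarrow> 1" by simp
  from scaled_tendsto[OF L_asymp this] show ?thesis
    by (rule Lim_transform_eventually)
      (use eventually_range in eventually_elim, simp add: B_down_def of_nat_diff mult_ac)
qed

lemma B_up_asymp: "(\<lambda>n. B_up n (m n) p * (a n / sqrt (real n))
    * exp (real n * rel_entropy (real (m n) / real n) p)) \<longlonglongrightarrow> sqrt (p * (1 - p) / (2 * pi))"
proof -
  have "(\<lambda>n. exp (1 / (12 * real n + 1) - 1 / (12 * real (m n) + 1) - 1 / (12 * real (n - m n) + 1))) \<longlonglongrightarrow> exp (0 - 0 - 0)"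
  proof (intro tendsto_intros)
    show *: "(\<lambda>n::nat. 1 / (12 * real n + 1)) \<longlonglongrightarrow> 0" by real_asymp
    show "(\<lambda>n. 1 / (12 * real (m n) + 1)) \<longlonglongrightarrow> 0" by (rule filterlim_compose[OF * m_at_top])
    show "(\<lambda>n. 1 / (12 * real (n - m n) + 1)) \<longlonglongrightarrow> 0" by (rule filterlim_compose[OF * n_minus_m_at_top])
  qed
  then have "(\<lambda>n. exp (1 / (12 * real n + 1) - 1 / (12 * real (m n) + 1) - 1 / (12 * real (n - m n) + 1))) \<longlonglongrightarrow> 1" by simp
  from scaled_tendsto[OF U_asymp this] show ?thesis
    by (rule Lim_transform_eventually)
      (use eventually_range in eventually_elim, simp add: B_up_def of_nat_diff mult_ac)
qed

text \<open>Here \<open>X\<close> is the tail divided by its largest term and \<open>Y\<close> is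
  the quotient of Stirling ratios; by \<open>binom_pt_stirling\<close> their product with the
  entropy factor restores the tail.\<close>

lemma binom_cdf_scaled_asymp: "(\<lambda>n. binom_cdf n (m n) p * (a n / sqrt (real n))
    * exp (real n * rel_entropy (real (m n) / real n) p)) \<longlonglongrightarrow> sqrt (p * (1 - p) / (2 * pi))"
proof -
  have "(\<lambda>n. stirling_ratio n / (stirling_ratio (m n) * stirling_ratio (n - m n))) \<longlonglongrightarrow> 1 / (1 * 1)"
    by (intro tendsto_intros stirling_ratio_tendsto
        filterlim_compose[OF stirling_ratio_tendsto m_at_top]
        filterlim_compose[OF stirling_ratio_tendsto n_minus_m_at_top]) simp
  then have "(\<lambda>n. stirling_ratio n / (stirling_ratio (m n) * stirling_ratio (n - m n))) \<longlonglongrightarrow> 1" by simp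
  from scaled_tendsto[OF binom_cdf_asymp this] show ?thesis
  proof (rule Lim_transform_eventually, use eventually_range in eventually_elim)
    case (elim n)
    define R where "R = stirling_ratio n / (stirling_ratio (m n) * stirling_ratio (n - m n))"
    define W where "W = sqrt (real n) / sqrt (2 * pi * real (m n) * (real n - real (m n)))
      * exp (- real n * rel_entropy (real (m n) / real n) p)"
    have "binom_pt n p (m n) = R * W"
      using binom_pt_stirling[of p "m n" n] elim p01 by (simp only: R_def W_def)
    then have "c * W * R = c * binom_pt n p (m n)" for c
      by (simp only: mult_ac)
    from this[of "binom_cdf n (m n) p / binom_pt n p (m n)"]
    have "binom_cdf n (m n) p / binom_pt n p (m n) * W * R = binom_cdf n (m n) p"
      using binom_pt_pos[of p "m n" n] elim p01 by (simp only: nonzero_eq_divide_eq) simp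
    then show ?case
      by (simp only: R_def W_def)
  qed
qed

end

section \<open>Passage from the floor back to the real sequence\<close>

theorem corollary2p3:
  fixes p q :: real and \<alpha> k f :: "nat \<Rightarrow> real"
  assumes "0 < p" and "p < 1" and "q = 1 - p"
    and "(\<lambda>n. \<alpha> n / real n) \<longlonglongrightarrow> 0"
    and "filterlim (\<lambda>n. \<alpha> n / sqrt (real n)) at_top sequentially"
    and "\<And>n. k n = p * real n - \<alpha> n"
    and "\<And>n. f n = k n / real n"
  shows "(\<lambda>n. B_down n (nat \<lfloor>k n\<rfloor>) p * (\<alpha> n / sqrt (real n))
              * exp (real n * rel_entropy (f n) p)) \<longlonglongrightarrow> sqrt (p * q / (2 * pi))
       \<and> (\<lambda>n. binom_cdf n (nat \<lfloor>k n\<rfloor>) p * (\<alpha> n / sqrt (real n))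
              * exp (real n * rel_entropy (f n) p)) \<longlonglongrightarrow> sqrt (p * q / (2 * pi))
       \<and> (\<lambda>n. B_up n (nat \<lfloor>k n\<rfloor>) p * (\<alpha> n / sqrt (real n))
              * exp (real n * rel_entropy (f n) p)) \<longlonglongrightarrow> sqrt (p * q / (2 * pi))"
proof -
  define m where "m n = nat \<lfloor>k n\<rfloor>" for n
  define a where "a n = p * real n - real (m n)" for n
  have f_lim: "f \<longlonglongrightarrow> p"
  proof -
    have "(\<lambda>n. p - \<alpha> n / real n) \<longlonglongrightarrow> p - 0"
      by (intro tendsto_intros assms)
    moreover have "eventually (\<lambda>n. p - \<alpha> n / real n = f n) sequentially"
      using eventually_gt_at_top[of 0] by eventually_elim (simp add: assms field_simps)
    ultimately show ?thesis by (simp add: tendsto_cong)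
  qed
  then have "eventually (\<lambda>n. f n > 0) sequentially"
    using assms(1) by (auto dest: order_tendstoD)
  \<comment> \<open>Since \<open>nat\<close> sends negative floors to \<open>0\<close>, the bounds
    \<open>m \<le> k \<le> m + 1\<close> are taken only once \<open>k\<close> is positive.\<close>
  then have near: "eventually (\<lambda>n. \<alpha> n \<le> a n \<and> a n \<le> \<alpha> n + 1) sequentially"
    using eventually_gt_at_top[of 0]
  proof eventually_elim
    case (elim n)
    then have "k n > 0" by (simp add: assms(7) zero_less_divide_iff)
    then have "real (m n) \<le> k n" "k n \<le> real (m n) + 1" unfolding m_def by linarith+
    then show ?case by (simp add: a_def assms(6))
  qed
  have small: "(\<lambda>n. a n / real n) \<longlonglongrightarrow> 0"
  proof (rule tendsto_sandwich[OF _ _ assms(4)])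
    show "eventually (\<lambda>n. \<alpha> n / real n \<le> a n / real n) sequentially"
      using near by eventually_elim (simp add: divide_right_mono)
    show "eventually (\<lambda>n. a n / real n \<le> \<alpha> n / real n + 1 / real n) sequentially"
      using near by eventually_elim (simp add: divide_right_mono flip: add_divide_distrib)
    show "(\<lambda>n. \<alpha> n / real n + 1 / real n) \<longlonglongrightarrow> 0"
      using tendsto_add[OF assms(4) lim_1_over_n] by simp
  qed
  have large: "filterlim (\<lambda>n. a n / sqrt (real n)) at_top sequentially"
    using assms(5)
    by (rule filterlim_at_top_mono) (use near in eventually_elim, simp add: divide_right_mono)
  interpret moderate_lower_tail p m a
    using assms(1,2) small large by unfold_locales (auto simp: a_def)
  have "(\<lambda>n. \<alpha> n / a n) \<longlonglongrightarrow> 1"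
  proof (rule tendsto_sandwich)
    show "eventually (\<lambda>n. 1 - 1 / a n \<le> \<alpha> n / a n) sequentially"
      using near eventually_range
    proof eventually_elim
      case (elim n)
      then have "1 - 1 / a n = (a n - 1) / a n" by (simp add: diff_divide_distrib)
      also have "\<dots> \<le> \<alpha> n / a n" using elim by (intro divide_right_mono) auto
      finally show ?case .
    qed
    show "eventually (\<lambda>n. \<alpha> n / a n \<le> 1) sequentially"
      using near eventually_range by eventually_elim (simp add: field_simps)
    show "(\<lambda>n. 1 - 1 / a n) \<longlonglongrightarrow> 1"
      using tendsto_diff[OF tendsto_const inverse_a_tendsto] by force
  qed simp
  \<comment> \<open>Here \<open>n\<close> times the distance of the arguments equals
    \<open>a - \<alpha>\<close>, which lies between \<open>0\<close> and \<open>1\<close>.\<close>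
  moreover have "(\<lambda>n. real n * (rel_entropy (f n) p - rel_entropy (real (m n) / real n) p)) \<longlonglongrightarrow> 0"
  proof (rule rel_entropy_diff_tendsto[OF assms(1,2) f_lim ratio_tendsto])
    show "eventually (\<lambda>n. real n * \<bar>f n - real (m n) / real n\<bar> \<le> 1) sequentially"
      using near eventually_range
    proof eventually_elim
      case (elim n)
      then have "f n - real (m n) / real n = (a n - \<alpha> n) / real n"
        by (simp add: assms(6,7) a_def field_simps)
      then show ?case using elim by (simp add: abs_divide)
    qed
  qed
  ultimately have corr: "(\<lambda>n. \<alpha> n / a n * exp (real n * (rel_entropy (f n) p - rel_entropy (real (m n) / real n) p)))
      \<longlonglongrightarrow> 1 * exp 0"
    by (intro tendsto_intros)
  \<comment> \<open>Multiplying by \<open>corr\<close> exchanges \<open>a\<close> for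
    \<open>\<alpha>\<close> and \<open>m / n\<close> for \<open>f\<close> at once, without changing
    the limit.\<close>
  have transfer: "(\<lambda>n. B n * (\<alpha> n / sqrt (real n)) * exp (real n * rel_entropy (f n) p)) \<longlonglongrightarrow> sqrt (p * q / (2 * pi))"
    if "(\<lambda>n. B n * (a n / sqrt (real n)) * exp (real n * rel_entropy (real (m n) / real n) p))
      \<longlonglongrightarrow> sqrt (p * (1 - p) / (2 * pi))" for B
  proof -
    have "(\<lambda>n. B n * (a n / sqrt (real n)) * exp (real n * rel_entropy (real (m n) / real n) p) *
        (\<alpha> n / a n * exp (real n * (rel_entropy (f n) p - rel_entropy (real (m n) / real n) p))))
      \<longlonglongrightarrow> sqrt (p * q / (2 * pi))"
      using tendsto_mult[OF that corr] by (simp add: assms(3))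
    then show ?thesis
      by (rule Lim_transform_eventually)
        (use eventually_range in eventually_elim, simp add: right_diff_distrib exp_diff)
  qed
  show ?thesis
    using transfer[OF B_down_asymp] transfer[OF binom_cdf_scaled_asymp] transfer[OF B_up_asymp]
    by (simp add: m_def)
qed
end
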